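(* Let $\Psi:\mathbb{N}\to\mathbb{R}_{>0}$ satisfy (i) $\Psi(x)=o(x^{-1})$ as $x\to\infty$, and (ii) $\Psi(lx)\le l\,\Psi(x)$ for all $l,x\in\mathbb{N}$. Let $I$ be any non-empty open real interval. Then the set $$\Big(\mathscr{K}_1(\Psi)\setminus \bigcup_{c<1}\mathscr{K}_1(c\Psi)\Big)\cap I$$ is uncountable. The same is true with $\mathscr{K}_1$ replaced by $\mathscr{K}_1^{\ast}$, and in that case condition (ii) may be dropped (only (i) is needed).
   Context: $\mathbb{N}=\{1,2,\dots\}$. For a function $\Psi:\mathbb{N}\to\mathbb{R}_{>0}$, $$\mathscr{K}_1(\Psi)=\{\zeta\in\mathbb{R}\setminus\mathbb{Q}:\ |\zeta q-p|\le \Psi(q)\text{ for infinitely many }(q,p)\in\mathbb{N}\times\mathbb{Z}\},$$ and $\mathscr{K}_1^{\ast}(\Psi)$ is defined in the same way but counting only pairs $(q,p)$ with $\gcd(q,p)=1$. The union is over all real constants $c<1$, and $c\Psi$ denotes the function $x\mapsto c\Psi(x)$. *)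

theory Defs
  imports "HOL-Analysis.Analysis" "HOL-Library.Landau_Symbols"
begin

text \<open>
  Functions on the positive integers are represented by functions on \<open>nat\<close> whose value at \<open>0\<close>
  is never inspected. The sets are defined for arbitrary real-valued functions, so that
  \<open>c \<Psi>\<close> is covered for every real \<open>c\<close>, including \<open>c \<le> 0\<close>.
\<close>

definition K1 :: "(nat \<Rightarrow> real) \<Rightarrow> real set" where
  "K1 \<Psi> = {\<zeta>. \<zeta> \<notin> \<rat> \<and>
     infinite {(q :: nat, p :: int). 1 \<le> q \<and> \<bar>\<zeta> * real q - real_of_int p\<bar> \<le> \<Psi> q}}"

definition K1_star :: "(nat \<Rightarrow> real) \<Rightarrow> real set" where
  "K1_star \<Psi> = {\<zeta>. \<zeta> \<notin> \<rat> \<and>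
     infinite {(q :: nat, p :: int). 1 \<le> q \<and> gcd (int q) p = 1 \<and>
       \<bar>\<zeta> * real q - real_of_int p\<bar> \<le> \<Psi> q}}"

end

theory Submission
  imports Defs
begin

text \<open>
  Construct the continued fraction of \<open>\<zeta>\<close> greedily: given denominators
  \<open>Q k\<close>, \<open>Q (k+1)\<close>, choose the next partial quotient so that
  \<open>1/\<Psi>(Q (k+1)) \<le> Q (k+2) \<le> 1/\<Psi>(Q (k+1)) + O(Q (k+1))\<close>. Since
  \<open>1/(Q (k+1) + Q (k+2)) < \<bar>Q (k+1) \<zeta> - P (k+1)\<bar> < 1/Q (k+2)\<close> and \<open>\<Psi>(x) = o(1/x)\<close>, every
  convergent satisfies the inequality with \<open>\<Psi>\<close>, but for \<open>c < 1\<close> only finitely many satisfy it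
  with \<open>c \<Psi>\<close>. By Legendre's theorem all other solutions are multiples of convergents, and these are
  controlled by \<open>\<Psi>(l x) \<le> l \<Psi>(x)\<close>. Two consecutive choices of the partial quotient are
  always admissible and lead to disjoint ranges for \<open>\<zeta>\<close>, so any given sequence of reals can be
  avoided by a diagonal argument.
\<close>

section \<open>Recurrences of convergents and nested segments\<close>

text \<open>The terms \<open>u * x\<close> and \<open>- v * y\<close> never have opposite signs, so
  nothing cancels. This turns linear relations between alternating errors into relations between
  their absolute values.\<close>

lemma abs_diff_opposite:
  fixes x y u v :: real
  assumes "x * y \<le> 0" "0 \<le> u * v"
  shows "\<bar>u * x - v * y\<bar> = \<bar>u\<bar> * \<bar>x\<bar> + \<bar>v\<bar> * \<bar>y\<bar>"
proof -
  have "(u * v) * (x * y) \<le> 0"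
    by (rule mult_nonneg_nonpos[OF assms(2,1)])
  then have "(u * x) * (v * y) \<le> 0" by (simp only: mult_ac)
  then have "\<bar>u * x - v * y\<bar> = \<bar>u * x\<bar> + \<bar>v * y\<bar>"
    unfolding mult_le_0_iff[of "u * x"] by linarith
  then show ?thesis by (simp add: abs_mult)
qed

text \<open>The recurrence starts from any two fractions of determinant 1 up to sign, so that both
  can be placed inside a prescribed interval. Note the shift: \<open>a k\<close> produces index
  \<open>k + 2\<close>.\<close>

locale convergents =
  fixes P Q a :: "nat \<Rightarrow> int"
  assumes Q0_pos: "0 < Q 0"
    and Q0_le_Q1: "Q 0 \<le> Q 1"
    and a_pos: "\<And>k. 1 \<le> a k"
    and P_rec: "\<And>k. P (Suc (Suc k)) = a k * P (Suc k) + P k"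
    and Q_rec: "\<And>k. Q (Suc (Suc k)) = a k * Q (Suc k) + Q k"
    and det0: "\<bar>P 1 * Q 0 - P 0 * Q 1\<bar> = 1"
begin

lemma Q_pos: "0 < Q k"
proof -
  have "0 < Q k \<and> Q k \<le> Q (Suc k)"
  proof (induction k)
    case 0
    then show ?case using Q0_pos Q0_le_Q1 by simp
  next
    case (Suc k)
    have "1 * Q (Suc k) \<le> a k * Q (Suc k)"
      using a_pos[of k] Suc by (intro mult_right_mono) auto
    then show ?case using Suc Q_rec[of k] by linarith
  qed
  then show ?thesis by simp
qed

lemma Q_ge_add: "Q (Suc k) + Q k \<le> Q (Suc (Suc k))"
proof -
  have "1 * Q (Suc k) \<le> a k * Q (Suc k)"
    using a_pos[of k] Q_pos[of "Suc k"] by (intro mult_right_mono) auto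
  then show ?thesis using Q_rec[of k] by simp
qed

text \<open>The shift is essential: the initial data allow \<open>Q 0 = Q 1\<close>.\<close>

lemma strict_mono_Q_Suc: "strict_mono (\<lambda>k. Q (Suc k))"
  unfolding strict_mono_Suc_iff
proof
  fix k
  show "Q (Suc k) < Q (Suc (Suc k))"
    using Q_ge_add[of k] Q_pos[of k] by linarith
qed

lemma Q_Suc_ge: "int k < Q (Suc k)"
proof (induction k)
  case 0
  then show ?case using Q_pos[of "Suc 0"] by simp
next
  case (Suc k)
  then show ?case using Q_ge_add[of k] Q_pos[of k] by simp
qed

lemma det_Suc: "\<bar>P (Suc k) * Q k - P k * Q (Suc k)\<bar> = 1"
proof (induction k)
  case 0
  then show ?case using det0 by simp
next
  case (Suc k)
  have "P (Suc (Suc k)) * Q (Suc k) - P (Suc k) * Q (Suc (Suc k))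
      = - (P (Suc k) * Q k - P k * Q (Suc k))"
    by (simp add: P_rec Q_rec algebra_simps)
  then show ?case using Suc by simp
qed

lemma coprime_QP: "coprime (Q k) (P k)"
proof (rule coprimeI)
  fix c assume "c dvd Q k" "c dvd P k"
  then have "c dvd P (Suc k) * Q k - P k * Q (Suc k)" by simp
  then have "c dvd \<bar>P (Suc k) * Q k - P k * Q (Suc k)\<bar>" by simp
  then show "is_unit c" by (simp only: det_Suc)
qed

abbreviation frac_conv :: "nat \<Rightarrow> real"
  where "frac_conv k \<equiv> of_int (P k) / of_int (Q k)"

lemma frac_conv_in_segment:
  "frac_conv (Suc (Suc k)) \<in> closed_segment (frac_conv k) (frac_conv (Suc k))"
proof -
  \<comment> \<open>The new convergent is a weighted mean of the two previous ones, with weights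
    proportional to \<open>Q k\<close> and \<open>a k * Q (Suc k)\<close>.\<close>
  define u where "u = of_int (a k) * of_int (Q (Suc k)) / (of_int (Q (Suc (Suc k))) :: real)"
  have pos: "(0::real) < of_int (Q k)" "(0::real) < of_int (Q (Suc k))"
    "(0::real) < of_int (Q (Suc (Suc k)))"
    using Q_pos by simp_all
  have rQ: "(of_int (Q (Suc (Suc k))) :: real) = of_int (a k) * of_int (Q (Suc k)) + of_int (Q k)"
    by (simp add: Q_rec)
  have rP: "(of_int (P (Suc (Suc k))) :: real) = of_int (a k) * of_int (P (Suc k)) + of_int (P k)"
    by (simp add: P_rec)
  have u1: "1 - u = of_int (Q k) / of_int (Q (Suc (Suc k)))"
    using pos rQ by (simp add: u_def field_simps)
  have "0 \<le> u" using pos a_pos[of k] by (simp add: u_def)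
  moreover have "0 \<le> 1 - u" using pos by (simp add: u1)
  moreover have "frac_conv (Suc (Suc k)) = (1 - u) * frac_conv k + u * frac_conv (Suc k)"
    unfolding u1 unfolding u_def using pos rP by (simp add: add_divide_distrib)
  ultimately show ?thesis by (auto simp: in_segment intro!: exI[of _ u])
qed

text \<open>The segments between consecutive convergents are compact and nested; any common point
  serves as the limit.\<close>

lemma exists_limit:
  obtains \<zeta> where "\<And>k. \<zeta> \<in> closed_segment (frac_conv k) (frac_conv (Suc k))"
proof -
  define F where "F k = closed_segment (frac_conv k) (frac_conv (Suc k))" for k
  have "F (Suc k) \<subseteq> F k" for k
    unfolding F_def using frac_conv_in_segment[of k] by (simp add: subset_closed_segment)
  then have "F n \<subseteq> F m" if "m \<le> n" for m n
    using that by (rule lift_Suc_antimono_le)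
  then have "\<Inter> (range F) \<noteq> {}"
    by (intro compact_nest) (auto simp: F_def)
  then show ?thesis using that by (auto simp: F_def)
qed

end

section \<open>Approximation errors of the convergents\<close>

locale convergents_limit = convergents +
  fixes \<zeta> :: real
  assumes limit: "\<And>k. \<zeta> \<in> closed_segment (frac_conv k) (frac_conv (Suc k))"
begin

text \<open>Being linear in \<open>Q k\<close> and \<open>P k\<close>, the signed error obeys the
  same recurrence as they do.\<close>

definition D :: "nat \<Rightarrow> real"
  where "D k = \<zeta> * of_int (Q k) - of_int (P k)"

lemma D_alternating: "D k * D (Suc k) \<le> 0"
proof -
  have pos: "(0::real) < of_int (Q k)" "(0::real) < of_int (Q (Suc k))"
    using Q_pos by simp_all
  have Dk: "D k = of_int (Q k) * (\<zeta> - frac_conv k)"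
    and DSuc: "D (Suc k) = of_int (Q (Suc k)) * (\<zeta> - frac_conv (Suc k))"
    using pos by (simp_all add: D_def field_simps)
  have *: "(\<zeta> - frac_conv k) * (\<zeta> - frac_conv (Suc k)) \<le> 0"
    using limit[of k] by (auto simp: closed_segment_eq_real_ivl mult_le_0_iff split: if_splits)
  have "D k * D (Suc k) = (of_int (Q k) * of_int (Q (Suc k)))
      * ((\<zeta> - frac_conv k) * (\<zeta> - frac_conv (Suc k)))"
    unfolding Dk DSuc by (simp add: mult_ac)
  also have "\<dots> \<le> 0"
    by (rule mult_nonneg_nonpos) (use * pos in simp_all)
  finally show ?thesis .
qed

text \<open>Eliminating \<zeta> from two consecutive errors leaves the determinant, and the errors
  have opposite signs, so the absolute values add up. Both bounds \<open>D_upper\<close> and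
  \<open>D_lower\<close> are read off from this identity.\<close>

lemma D_det: "of_int (Q (Suc k)) * \<bar>D k\<bar> + of_int (Q k) * \<bar>D (Suc k)\<bar> = 1"
proof -
  have "of_int (Q (Suc k)) * D k - of_int (Q k) * D (Suc k)
     = of_int (P (Suc k) * Q k - P k * Q (Suc k))"
    by (simp add: D_def algebra_simps)
  then have "\<bar>of_int (Q (Suc k)) * D k - of_int (Q k) * D (Suc k)\<bar>
     = of_int \<bar>P (Suc k) * Q k - P k * Q (Suc k)\<bar>" by simp
  then have "\<bar>of_int (Q (Suc k)) * D k - of_int (Q k) * D (Suc k)\<bar> = 1"
    by (simp only: det_Suc of_int_1)
  then show ?thesis
    using abs_diff_opposite[OF D_alternating[of k], of "of_int (Q (Suc k))" "of_int (Q k)"]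
      Q_pos[of k] Q_pos[of "Suc k"] by simp
qed

lemma D_rec: "\<bar>D k\<bar> = \<bar>D (Suc (Suc k))\<bar> + of_int (a k) * \<bar>D (Suc k)\<bar>"
proof -
  have "D k = of_int 1 * D (Suc (Suc k)) - of_int (a k) * D (Suc k)"
    by (simp add: D_def P_rec Q_rec algebra_simps)
  then show ?thesis
    using abs_diff_opposite[of "D (Suc (Suc k))" "D (Suc k)" 1 "of_int (a k)"]
      D_alternating[of "Suc k"] a_pos[of k] by (simp add: mult.commute)
qed

lemma D_antimono_Suc: "\<bar>D (Suc k)\<bar> + \<bar>D (Suc (Suc k))\<bar> \<le> \<bar>D k\<bar>"
proof -
  have "1 * \<bar>D (Suc k)\<bar> \<le> of_int (a k) * \<bar>D (Suc k)\<bar>"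
    using a_pos[of k] by (intro mult_right_mono) auto
  then show ?thesis using D_rec[of k] by simp
qed

text \<open>This is what makes \<open>D_upper\<close> and \<open>D_lower\<close> strict and \<zeta>
  irrational.\<close>

lemma D_nonzero: "D k \<noteq> 0"
proof
  assume "D k = 0"
  with D_antimono_Suc[of k] have "D (Suc k) = 0" by simp
  with \<open>D k = 0\<close> show False using D_det[of k] by simp
qed

lemma D_antimono: "j \<le> k \<Longrightarrow> \<bar>D k\<bar> \<le> \<bar>D j\<bar>"
proof (rule lift_Suc_antimono_le[of "\<lambda>k. \<bar>D k\<bar>"])
  fix k show "\<bar>D (Suc k)\<bar> \<le> \<bar>D k\<bar>" using D_antimono_Suc[of k] by simp
qed

lemma D_upper: "\<bar>D k\<bar> < 1 / of_int (Q (Suc k))"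
proof -
  have "0 < of_int (Q k) * \<bar>D (Suc k)\<bar>"
    using Q_pos[of k] D_nonzero[of "Suc k"] by simp
  then have "of_int (Q (Suc k)) * \<bar>D k\<bar> < 1" using D_det[of k] by linarith
  then show ?thesis using Q_pos[of "Suc k"] by (simp add: field_simps)
qed

lemma D_lower: "1 / (of_int (Q (Suc k)) + of_int (Q k)) < \<bar>D k\<bar>"
proof -
  have "\<bar>D (Suc k)\<bar> < \<bar>D k\<bar>"
    using D_antimono_Suc[of k] D_nonzero[of "Suc (Suc k)"] by simp
  then have "of_int (Q k) * \<bar>D (Suc k)\<bar> < of_int (Q k) * \<bar>D k\<bar>"
    using Q_pos[of k] by simp
  then have "1 < (of_int (Q (Suc k)) + of_int (Q k)) * \<bar>D k\<bar>"
    using D_det[of k] by (simp add: algebra_simps)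
  moreover have "0 < (of_int (Q (Suc k)) + of_int (Q k) :: real)"
    using Q_pos[of k] Q_pos[of "Suc k"] by (simp add: add_pos_pos)
  ultimately show ?thesis by (simp add: field_simps)
qed

lemma limit_irrational: "\<zeta> \<notin> \<rat>"
proof
  assume "\<zeta> \<in> \<rat>"
  then obtain r s :: int where rs: "0 < s" "\<zeta> = of_int r / of_int s"
    by (metis Rats_cases')
  \<comment> \<open>With this index \<open>Q (Suc k)\<close> exceeds the denominator
    \<open>s\<close>, so \<open>of_int s * D k\<close> would be a nonzero integer of absolute value
    below 1.\<close>
  define k where "k = nat s"
  have "of_int s * D k = of_int (r * Q k - s * P k)"
    using rs by (simp add: D_def field_simps)
  moreover have "r * Q k - s * P k \<noteq> 0"
    using calculation D_nonzero[of k] rs(1)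
    by (metis mult_eq_0_iff of_int_0 of_int_eq_0_iff less_irrefl)
  then have "(1::real) \<le> \<bar>of_int (r * Q k - s * P k)\<bar>" by linarith
  ultimately have "1 \<le> of_int s * \<bar>D k\<bar>"
    using rs(1) by (metis abs_mult abs_of_pos of_int_0_less_iff)
  moreover have "s < Q (Suc k)" using Q_Suc_ge[of k] rs(1) by (simp add: k_def)
  then have "(of_int s :: real) < of_int (Q (Suc k))" by simp
  then have "of_int s * \<bar>D k\<bar> < of_int (Q (Suc k)) * \<bar>D k\<bar>"
    using D_nonzero[of k] by simp
  moreover have "of_int (Q (Suc k)) * \<bar>D k\<bar> < 1"
    using D_upper[of k] Q_pos[of "Suc k"] by (simp add: field_simps)
  ultimately show False by linarith
qed

section \<open>Best approximation and Legendre's theorem\<close>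

text \<open>Two consecutive convergents form a basis of the integer lattice. In this basis the size
  of \<open>q\<close> forces signs of the coordinates for which the two error contributions add up,
  and the coordinate along index \<open>k\<close> is nonzero.\<close>

lemma best_approximation:
  assumes q: "0 < q" "q < Q (Suc k)"
  shows "\<bar>D k\<bar> \<le> \<bar>\<zeta> * of_int q - of_int p\<bar>"
proof -
  define e where "e = P (Suc k) * Q k - P k * Q (Suc k)"
  have "\<bar>e\<bar> = 1" using det_Suc[of k] by (simp add: e_def)
  then have e: "e * e = 1" by (metis abs_mult_self_eq mult_1)
  \<comment> \<open>Cramer's rule; the determinant \<open>e\<close> is its own inverse. The minus
    sign in front of \<open>y\<close> below matches \<open>abs_diff_opposite\<close>.\<close>
  define x where "x = e * (P (Suc k) * q - p * Q (Suc k))"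
  define y where "y = e * (P k * q - p * Q k)"
  have "x * Q k - y * Q (Suc k) = e * e * q"
    by (simp add: x_def y_def e_def algebra_simps)
  then have qxy: "q = x * Q k - y * Q (Suc k)" using e by simp
  have "x * P k - y * P (Suc k) = e * e * p"
    by (simp add: x_def y_def e_def algebra_simps)
  then have pxy: "p = x * P k - y * P (Suc k)" using e by simp
  have x0: "x \<noteq> 0"
  proof
    assume "x = 0"
    with qxy q have "- y * Q (Suc k) > 0" "- y * Q (Suc k) < 1 * Q (Suc k)" by auto
    then show False using Q_pos[of "Suc k"]
      by (simp only: mult_less_cancel_right zero_less_mult_iff) auto
  qed
  \<comment> \<open>Opposite signs would make \<open>q\<close> either negative or larger than
    \<open>Q (Suc k)\<close>.\<close>
  have "0 \<le> x * y"
  proof (rule ccontr)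
    assume "\<not> 0 \<le> x * y"
    then consider "x < 0" "0 < y" | "0 < x" "y < 0"
      by (metis linorder_not_le mult_nonneg_nonneg mult_nonpos_nonpos order_less_le
          mult_zero_left mult_zero_right linorder_neqE_linordered_idom)
    then show False
    proof cases
      case 1
      then have "x * Q k < 0" "0 < y * Q (Suc k)"
        using Q_pos by (auto simp: mult_neg_pos)
      then show False using qxy q by linarith
    next
      case 2
      then have "0 < x * Q k" using Q_pos by auto
      moreover have "y * Q (Suc k) \<le> (-1) * Q (Suc k)"
        using 2 Q_pos[of "Suc k"] by (intro mult_right_mono) auto
      ultimately show False using qxy q by linarith
    qed
  qed
  then have "0 \<le> of_int x * (of_int y :: real)" by (metis of_int_0_le_iff of_int_mult)
  then have "\<bar>of_int x * D k - of_int y * D (Suc k)\<bar>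
      = \<bar>of_int x\<bar> * \<bar>D k\<bar> + \<bar>of_int y\<bar> * \<bar>D (Suc k)\<bar>"
    by (intro abs_diff_opposite D_alternating)
  moreover have "\<zeta> * of_int q - of_int p = of_int x * D k - of_int y * D (Suc k)"
    by (subst qxy, subst pxy) (simp add: D_def algebra_simps)
  moreover have "1 * \<bar>D k\<bar> \<le> \<bar>of_int x\<bar> * \<bar>D k\<bar>"
    using x0 by (intro mult_right_mono) linarith+
  moreover have "0 \<le> \<bar>of_int y\<bar> * \<bar>D (Suc k)\<bar>" by simp
  ultimately show ?thesis by linarith
qed

text \<open>With \<open>Q k\<close> the last denominator not exceeding \<open>q\<close>, the integer
  \<open>p * Q k - P k * q\<close> is below 1 in absolute value, hence zero, and coprimality yields
  the multiple. The bound \<open>Q 0 \<le> q\<close> guarantees that such a \<open>k\<close>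
  exists.\<close>

lemma legendre:
  assumes q: "Q 0 \<le> q" and close: "\<bar>\<zeta> * of_int q - of_int p\<bar> < 1 / (2 * of_int q)"
  obtains k l where "1 \<le> l" "q = l * Q k" "p = l * P k"
proof -
  have q0: "0 < q" using q Q_pos[of 0] by linarith
  have "q < Q (Suc (nat q))"
    using Q_Suc_ge[of "nat q"] q0 by simp
  then obtain k where "\<forall>i\<le>k. \<not> q < Q i" "q < Q (Suc k)"
    using ex_least_nat_less[of "\<lambda>n. q < Q n" "Suc (nat q)"] q by auto
  then have k: "Q k \<le> q" "q < Q (Suc k)" by auto
  define x where "x = \<bar>\<zeta> * of_int q - of_int p\<bar>"
  have Dx: "\<bar>D k\<bar> \<le> x" unfolding x_def using best_approximation q0 k by blast
  have rq: "(0::real) < of_int (Q k)" "of_int (Q k) \<le> (of_int q :: real)"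
    using k Q_pos[of k] by simp_all
  have "of_int (p * Q k - P k * q) = of_int q * D k - of_int (Q k) * (\<zeta> * of_int q - of_int p)"
    by (simp add: D_def algebra_simps)
  also have "\<bar>\<dots>\<bar> \<le> \<bar>of_int q * D k\<bar> + \<bar>of_int (Q k) * (\<zeta> * of_int q - of_int p)\<bar>"
    by (rule abs_triangle_ineq4)
  also have "\<dots> = of_int q * \<bar>D k\<bar> + of_int (Q k) * x"
    using rq by (simp add: abs_mult x_def)
  also have "\<dots> \<le> of_int q * x + of_int q * x"
    using rq Dx by (intro add_mono mult_left_mono mult_right_mono) (auto simp: x_def)
  also have "\<dots> < 1" using close rq by (simp add: x_def field_simps)
  finally have "p * Q k = P k * q" by linarith
  then have eq: "P k * q = p * Q k" by simp
  then have "Q k dvd P k * q" by simp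
  then have "Q k dvd q" using coprime_QP[of k] by (simp add: coprime_dvd_mult_right_iff)
  then obtain l where l: "q = Q k * l" by auto
  have "1 \<le> l" using l q0 Q_pos[of k] by (smt (verit) zero_less_mult_iff)
  moreover have "p = l * P k" using eq l Q_pos[of k] by auto
  ultimately show ?thesis using that l by (simp add: mult.commute)
qed

end

section \<open>Convergents tuned to \<Psi>\<close>

text \<open>The slack of three times \<open>Q (Suc k)\<close> pays for rounding the partial quotient
  up, for the summand \<open>Q k\<close>, and for a free choice between two consecutive
  quotients.\<close>

locale tuned_convergents = convergents_limit +
  fixes \<Psi> :: "nat \<Rightarrow> real"
  assumes Psi_pos: "\<And>x. 1 \<le> x \<Longrightarrow> 0 < \<Psi> x"
    and Psi_small: "\<Psi> \<in> o(\<lambda>x. 1 / real x)"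
    and next_ge: "\<And>k. 1 / \<Psi> (nat (Q (Suc k))) \<le> of_int (Q (Suc (Suc k)))"
    and next_le: "\<And>k. of_int (Q (Suc (Suc k)))
      \<le> 1 / \<Psi> (nat (Q (Suc k))) + 3 * of_int (Q (Suc k))"
begin

lemma Psi_Q_pos: "0 < \<Psi> (nat (Q k))"
  using Q_pos[of k] by (intro Psi_pos) linarith

lemma D_le_Psi: "\<bar>D (Suc k)\<bar> \<le> \<Psi> (nat (Q (Suc k)))"
proof -
  have "1 / of_int (Q (Suc (Suc k))) \<le> \<Psi> (nat (Q (Suc k)))"
    using next_ge[of k] Psi_Q_pos[of "Suc k"] Q_pos[of "Suc (Suc k)"]
    by (simp add: field_simps)
  then show ?thesis using D_upper[of "Suc k"] by linarith
qed

text \<open>The factor tends to 1 along the convergents because \<Psi>(x) = o(1/x). Its constant 4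
  is the 3 of \<open>next_le\<close> plus one more \<open>Q (Suc k)\<close> from the denominator in
  \<open>D_lower\<close>.\<close>

lemma Psi_less_D:
  "\<Psi> (nat (Q (Suc k))) < (1 + 4 * (of_int (Q (Suc k)) * \<Psi> (nat (Q (Suc k))))) * \<bar>D (Suc k)\<bar>"
proof -
  define w where "w = \<Psi> (nat (Q (Suc k)))"
  define t where "t = (of_int (Q (Suc (Suc k))) + of_int (Q (Suc k)) :: real)"
  have w: "0 < w" using Psi_Q_pos by (simp add: w_def)
  have t: "0 < t" using Q_pos[of "Suc k"] Q_pos[of "Suc (Suc k)"] by (simp add: t_def add_pos_pos)
  have "t \<le> 1 / w + 4 * of_int (Q (Suc k))"
    using next_le[of k] by (simp add: t_def w_def)
  then have "w * t \<le> w * (1 / w + 4 * of_int (Q (Suc k)))"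
    using w by (intro mult_left_mono) auto
  also have "\<dots> = 1 + 4 * (of_int (Q (Suc k)) * w)" using w by (simp add: algebra_simps)
  finally have wt: "w * t \<le> 1 + 4 * (of_int (Q (Suc k)) * w)" .
  have "1 < t * \<bar>D (Suc k)\<bar>"
    using D_lower[of "Suc k"] t by (simp add: t_def field_simps)
  then have "w * 1 < w * (t * \<bar>D (Suc k)\<bar>)" using w by (intro mult_strict_left_mono)
  also have "\<dots> = (w * t) * \<bar>D (Suc k)\<bar>" by simp
  also have "\<dots> \<le> (1 + 4 * (of_int (Q (Suc k)) * w)) * \<bar>D (Suc k)\<bar>"
    using wt by (intro mult_right_mono) auto
  finally show ?thesis by (simp add: w_def)
qed

lemma infinite_convergent_pairs: "infinite (range (\<lambda>k. (nat (Q (Suc k)), P (Suc k))))"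
proof (rule range_inj_infinite, rule injI)
  fix j k
  assume "(nat (Q (Suc j)), P (Suc j)) = (nat (Q (Suc k)), P (Suc k))"
  then have "Q (Suc j) = Q (Suc k)"
    using Q_pos[of "Suc j"] Q_pos[of "Suc k"] by (simp add: eq_nat_nat_iff)
  then show "j = k" using strict_mono_eq[OF strict_mono_Q_Suc] by simp
qed

lemma limit_in_K1_star: "\<zeta> \<in> K1_star \<Psi>"
proof -
  have "range (\<lambda>k. (nat (Q (Suc k)), P (Suc k)))
    \<subseteq> {(q, p). 1 \<le> q \<and> gcd (int q) p = 1 \<and> \<bar>\<zeta> * real q - of_int p\<bar> \<le> \<Psi> q}"
  proof safe
    fix k
    have pos: "0 < Q (Suc k)" by (rule Q_pos)
    then show "1 \<le> nat (Q (Suc k))" by simp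
    show "gcd (int (nat (Q (Suc k)))) (P (Suc k)) = 1"
      using coprime_QP[of "Suc k"] pos by simp
    show "\<bar>\<zeta> * real (nat (Q (Suc k))) - of_int (P (Suc k))\<bar> \<le> \<Psi> (nat (Q (Suc k)))"
      using D_le_Psi[of k] pos by (simp add: D_def)
  qed
  then show ?thesis
    using infinite_convergent_pairs limit_irrational infinite_super
    unfolding K1_star_def by blast
qed

lemma limit_in_K1: "\<zeta> \<in> K1 \<Psi>"
proof -
  have "{(q, p). 1 \<le> q \<and> gcd (int q) p = 1 \<and> \<bar>\<zeta> * real q - of_int p\<bar> \<le> \<Psi> q}
    \<subseteq> {(q, p). 1 \<le> q \<and> \<bar>\<zeta> * real q - of_int p\<bar> \<le> \<Psi> q}" by auto
  then show ?thesis
    using limit_in_K1_star infinite_super unfolding K1_def K1_star_def by blast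
qed

text \<open>Common core of both non-membership claims. Large solutions are multiples of convergents
  by \<open>legendre\<close>; the assumption \<open>mult\<close> isolates the only point where the
  coprime and the general case differ.\<close>

lemma finite_improved_solutions:
  assumes c: "c < 1"
    and S: "\<And>q p. (q, p) \<in> S \<Longrightarrow> 1 \<le> q \<and> \<bar>\<zeta> * real q - of_int p\<bar> \<le> c * \<Psi> q"
    and mult: "\<And>q p k l. (q, p) \<in> S \<Longrightarrow> 1 \<le> l \<Longrightarrow> int q = l * Q k \<Longrightarrow> p = l * P k
      \<Longrightarrow> \<Psi> q \<le> of_int l * \<Psi> (nat (Q k))"
  shows "finite S"
proof (cases "c < 0")
  case True
  have "(q, p) \<notin> S" for q p
    using S[of q p] Psi_pos[of q] mult_neg_pos[OF True, of "\<Psi> q"] by force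
  then have "S = {}" by auto
  then show ?thesis by simp
next
  case False
  then have c0: "0 \<le> c" by simp
  \<comment> \<open>Chosen so that \<open>c * (1 + 4 * e) < 1\<close>, while
    \<open>e < 1 / 2\<close> supplies the hypothesis of \<open>legendre\<close>.\<close>
  define e where "e = (1 - c) / 5"
  have e: "0 < e" "e < 1 / 2" using c c0 by (auto simp: e_def)
  have "c * (4 * e) \<le> 1 * (4 * e)" using c e by (intro mult_right_mono) auto
  then have ce: "c * (1 + 4 * e) < 1" using c
    unfolding e_def distrib_left by argo
  have "eventually (\<lambda>x. norm (\<Psi> x) \<le> e * norm (1 / real x)) at_top"
    using landau_o.smallD[OF Psi_small] e by blast
  then obtain M where M: "\<And>x. M \<le> x \<Longrightarrow> norm (\<Psi> x) \<le> e * norm (1 / real x)"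
    by (auto simp: eventually_at_top_linorder)
  have small: "real x * \<Psi> x \<le> e" if "M \<le> x" "1 \<le> x" for x
    using M[OF that(1)] that(2) Psi_pos[OF that(2)] by (simp add: field_simps)
  define B where "B = 1 / (2 * \<bar>D (Suc M)\<bar>)"
  \<comment> \<open>Beyond \<open>N\<close>, \<Psi> is small, \<open>legendre\<close> applies, and
    \<open>q\<close> is too large to be a close multiple of a convergent of index at most
    \<open>Suc M\<close>, whose error is at least \<open>\<bar>D (Suc M)\<bar>\<close>.\<close>
  define N where "N = M + nat (Q 0) + nat \<lceil>B\<rceil>"
  have bound: "q \<le> N" if qp: "(q, p) \<in> S" for q p
  proof (rule ccontr)
    assume "\<not> q \<le> N"
    then have q: "M \<le> q" "1 \<le> q" "Q 0 \<le> int q" "B < real q"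
      unfolding N_def by linarith+
    have Psi_q: "0 < \<Psi> q" using Psi_pos q(2) .
    have "\<bar>\<zeta> * real q - of_int p\<bar> \<le> c * \<Psi> q" using S[OF qp] by simp
    also have "\<dots> \<le> 1 * \<Psi> q" using c Psi_q by (intro mult_right_mono) auto
    also have "1 * \<Psi> q < 1 / (2 * real q)"
    proof -
      have "real q * \<Psi> q < 1 / 2" using small[OF q(1,2)] e by linarith
      then show ?thesis using q(2) by (simp add: field_simps)
    qed
    finally have close: "\<bar>\<zeta> * real q - of_int p\<bar> < 1 / (2 * real q)" .
    then have "\<bar>\<zeta> * of_int (int q) - of_int p\<bar> < 1 / (2 * of_int (int q))" by simp
    then obtain k l where kl: "1 \<le> l" "int q = l * Q k" "p = l * P k"
      using legendre[OF q(3)] by blast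
    have rq: "real q = of_int l * of_int (Q k)" using kl(2) by (metis of_int_mult of_int_of_nat_eq)
    have Dl: "\<bar>\<zeta> * real q - of_int p\<bar> = of_int l * \<bar>D k\<bar>"
    proof -
      have "\<zeta> * real q - of_int p = of_int l * D k"
        by (simp add: rq kl(3) D_def algebra_simps)
      then show ?thesis using kl(1) by (simp add: abs_mult)
    qed
    show False
    proof (cases "k \<le> Suc M")
      case True
      have "1 * \<bar>D (Suc M)\<bar> \<le> of_int l * \<bar>D k\<bar>"
        using kl(1) D_antimono[OF True] by (intro mult_mono) auto
      then have "\<bar>D (Suc M)\<bar> < 1 / (2 * real q)" using close Dl by linarith
      then have "real q < B" using q(2) D_nonzero[of "Suc M"] by (simp add: B_def field_simps)
      then show False using q(4) by simp
    next
      case False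
      \<comment> \<open>For these late convergents \<open>c * w < \<bar>D k\<bar>\<close>. Scaling
        by \<open>l\<close> contradicts the improved inequality combined with
        \<open>mult\<close>.\<close>
      then obtain j where j: "k = Suc j" "M \<le> j" by (cases k) auto
      define w where "w = \<Psi> (nat (Q k))"
      have "M \<le> nat (Q k)" "1 \<le> nat (Q k)" using Q_Suc_ge[of j] j by auto
      from small[OF this] have "of_int (Q k) * w \<le> e"
        using Q_pos[of k] by (simp add: w_def)
      then have "(1 + 4 * (of_int (Q k) * w)) * \<bar>D k\<bar> \<le> (1 + 4 * e) * \<bar>D k\<bar>"
        by (intro mult_right_mono) auto
      then have "w < (1 + 4 * e) * \<bar>D k\<bar>"
        using Psi_less_D[of j] by (simp add: w_def j)
      then have "c * w \<le> c * ((1 + 4 * e) * \<bar>D k\<bar>)"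
        using c0 by (intro mult_left_mono) auto
      also have "\<dots> = (c * (1 + 4 * e)) * \<bar>D k\<bar>" by simp
      also have "\<dots> < 1 * \<bar>D k\<bar>"
        using ce D_nonzero[of k] by (intro mult_strict_right_mono) auto
      finally have "of_int l * (c * w) < of_int l * \<bar>D k\<bar>"
        using kl(1) by simp
      also have "\<dots> \<le> c * \<Psi> q" using S[OF qp] Dl by simp
      also have "\<dots> \<le> c * (of_int l * w)"
        using mult[OF qp kl] c0 by (intro mult_left_mono) (auto simp: w_def)
      finally show False by (simp add: algebra_simps)
    qed
  qed
  \<comment> \<open>For each of the finitely many \<open>q\<close>, the integer \<open>p\<close> is
    confined to a bounded range.\<close>
  define R where "R q = \<lceil>\<bar>\<zeta> * real q\<bar> + c * \<Psi> q\<rceil>" for q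
  have "S \<subseteq> (SIGMA q:{..N}. {- R q..R q})"
  proof safe
    fix q p assume qp: "(q, p) \<in> S"
    then have "\<bar>of_int p\<bar> \<le> \<bar>\<zeta> * real q\<bar> + c * \<Psi> q" using S[OF qp] by linarith
    then have "\<bar>p\<bar> \<le> R q" unfolding R_def by linarith
    then show "p \<in> {- R q..R q}" by auto
  qed (use bound in auto)
  then show ?thesis by (rule finite_subset) auto
qed

text \<open>A coprime pair that is \<open>l\<close> times a convergent has \<open>l = 1\<close>,
  which makes the growth condition on \<Psi> trivial.\<close>

lemma limit_notin_K1_star:
  assumes c: "c < 1"
  shows "\<zeta> \<notin> K1_star (\<lambda>x. c * \<Psi> x)"
proof -
  have "finite {(q, p). 1 \<le> q \<and> gcd (int q) p = 1 \<and> \<bar>\<zeta> * real q - of_int p\<bar> \<le> c * \<Psi> q}"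
  proof (rule finite_improved_solutions[OF c], goal_cases)
    case (2 q p k l)
    then have "l dvd gcd (int q) p" by (metis dvd_triv_left gcd_greatest)
    moreover have "gcd (int q) p = 1" using 2 by simp
    ultimately have "\<bar>l\<bar> = 1" by (simp only: zdvd1_eq)
    then have "l = 1" using 2 by linarith
    then show ?case using 2 by (metis nat_int mult_1 of_int_1 order_refl)
  qed auto
  then show ?thesis unfolding K1_star_def by blast
qed

lemma limit_notin_K1:
  assumes sub: "\<And>l x. 1 \<le> l \<Longrightarrow> 1 \<le> x \<Longrightarrow> \<Psi> (l * x) \<le> real l * \<Psi> x" and c: "c < 1"
  shows "\<zeta> \<notin> K1 (\<lambda>x. c * \<Psi> x)"
proof -
  have "finite {(q, p). 1 \<le> q \<and> \<bar>\<zeta> * real q - of_int p\<bar> \<le> c * \<Psi> q}"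
  proof (rule finite_improved_solutions[OF c], goal_cases)
    case (2 q p k l)
    then have "q = nat l * nat (Q k)"
      by (metis nat_int nat_mult_distrib zero_le_one order_trans)
    then show ?case using sub[of "nat l" "nat (Q k)"] 2 Q_pos[of k] by simp
  qed auto
  then show ?thesis unfolding K1_def by blast
qed

end

section \<open>Construction of a limit avoiding a given sequence\<close>

text \<open>
  The last conclusion forces \<open>\<zeta> \<noteq> z\<close>, because the limit satisfies both strict reverse inequalities.
\<close>

lemma next_partial_quotient:
  fixes p' q q' :: int and \<psi> z :: real
  assumes "0 < \<psi>" "0 < q" "q \<le> q'"
  obtains a :: int where "1 \<le> a"
    "1 / \<psi> \<le> of_int (a * q' + q)" "of_int (a * q' + q) \<le> 1 / \<psi> + 3 * of_int q'"
    "\<bar>z * of_int q' - of_int p'\<bar> \<le> 1 / (of_int (a * q' + q) + of_int q') \<or>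
     1 / of_int (a * q' + q) \<le> \<bar>z * of_int q' - of_int p'\<bar>"
proof -
  define a where "a = \<lceil>1 / (\<psi> * of_int q')\<rceil>"
  have q': "(0::real) < of_int q'" "(0::real) < of_int q" "of_int q \<le> (of_int q' :: real)"
    using assms by auto
  have a1: "1 \<le> a" using q' assms by (simp add: a_def)
  have "1 / (\<psi> * of_int q') * of_int q' \<le> of_int a * of_int q'"
    using q' by (intro mult_right_mono) (auto simp: a_def)
  then have lo: "1 / \<psi> \<le> of_int a * of_int q'" using q' by simp
  have "of_int a \<le> 1 / (\<psi> * of_int q') + 1" unfolding a_def by linarith
  then have "of_int a * of_int q' \<le> (1 / (\<psi> * of_int q') + 1) * of_int q'"
    using q' by (intro mult_right_mono) auto
  then have up: "of_int a * of_int q' \<le> 1 / \<psi> + of_int q'"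
    using q' by (simp add: distrib_right)
  show ?thesis
  proof (cases "\<bar>z * of_int q' - of_int p'\<bar> \<le> 1 / (of_int (a * q' + q) + of_int q')")
    case True
    then show ?thesis using that[of a] a1 lo up q' by simp
  next
    case False
    \<comment> \<open>Raising the quotient by one adds \<open>q'\<close> to the denominator, so the
      failed upper bound for \<open>a\<close> is exactly the lower bound required for
      \<open>a + 1\<close>.\<close>
    have "(a + 1) * q' + q = a * q' + q + q'" by (simp add: algebra_simps)
    then have eq: "of_int ((a + 1) * q' + q) = (of_int (a * q' + q) + of_int q' :: real)"
      by (metis of_int_add)
    show ?thesis
      by (rule that[of "a + 1"]) (use a1 lo up q' False in \<open>simp_all only: eq\<close>, auto)
  qed
qed

text \<open>Pick a rational \<open>a / b\<close> in \<open>I\<close>. A Bezout relation gives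
  fractions \<open>(n * a + v) / (n * b - u)\<close> of determinant 1 with it, at distance
  \<open>1 / (b * q')\<close>, which is small for large \<open>n\<close>.\<close>

lemma adjacent_fractions_in_open:
  fixes I :: "real set"
  assumes "open I" "I \<noteq> {}"
  obtains p q p' q' :: int where "0 < q" "q \<le> q'" "\<bar>p' * q - p * q'\<bar> = 1"
    "of_int p / of_int q \<in> I" "of_int p' / of_int q' \<in> I"
proof -
  obtain x where "x \<in> I" using assms by auto
  then obtain e where e: "0 < e" "ball x e \<subseteq> I" using assms open_contains_ball by blast
  then obtain r where r: "r \<in> \<rat>" "x < r" "r < x + e"
    using Rats_dense_in_real[of x "x + e"] by auto
  then have rI: "r \<in> I" using e by (auto simp: subset_iff dist_real_def)
  then obtain d where d: "0 < d" "ball r d \<subseteq> I" using assms open_contains_ball by blast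
  obtain a b :: int where ab: "0 < b" "coprime a b" "r = of_int a / of_int b"
    using r(1) by (metis Rats_cases')
  obtain u v where uv: "u * a + v * b = 1"
    using bezout_int[of a b] ab(2) by auto
  \<comment> \<open>Large enough for \<open>q' \<ge> b + \<lceil>1 / d\<rceil>\<close>, which gives
    both the order of the denominators and a distance below \<open>d\<close>.\<close>
  define n where "n = \<bar>u\<bar> + b + \<lceil>1 / d\<rceil>"
  have cd: "0 < \<lceil>1 / d\<rceil>" using d by simp
  have n0: "0 \<le> n" using ab cd unfolding n_def by linarith
  define q' where "q' = n * b - u"
  define p' where "p' = n * a + v"
  have "n * 1 \<le> n * b" using n0 ab by (intro mult_left_mono) auto
  then have q'ge: "b + \<lceil>1 / d\<rceil> \<le> q'" by (simp add: q'_def n_def)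
  have det: "p' * b - a * q' = 1" using uv by (simp add: p'_def q'_def algebra_simps)
  have q'pos: "0 < q'" using q'ge ab cd by linarith
  have "of_int p' / of_int q' - r = (of_int (p' * b - a * q') :: real) / (of_int b * of_int q')"
    using q'pos ab by (simp add: field_simps)
  then have diff: "of_int p' / of_int q' - r = 1 / (of_int b * of_int q')" by (simp add: det)
  have "1 / d < of_int q'" using q'ge ab(1) by linarith
  also have "1 * of_int q' \<le> of_int b * (of_int q' :: real)"
    using ab(1) q'pos by (intro mult_right_mono) auto
  finally have "1 / (of_int b * of_int q') < d"
    using d(1) ab(1) q'pos by (simp add: field_simps)
  moreover have "0 < 1 / (of_int b * of_int q' :: real)" using ab q'pos by simp
  ultimately have "of_int p' / of_int q' \<in> ball r d"
    using diff unfolding mem_ball dist_real_def by linarith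
  then show ?thesis
    using that[of b q' p' a] ab q'ge cd det rI d(2) by auto
qed

text \<open>Dependent choice on states made of two consecutive convergents. Stage \<open>n\<close>
  chooses its quotient against \<open>z n\<close>.\<close>

lemma exists_tuned_convergents:
  fixes \<Psi> z :: "nat \<Rightarrow> real" and I :: "real set"
  assumes pos: "\<And>x. 1 \<le> x \<Longrightarrow> 0 < \<Psi> x"
    and small: "\<Psi> \<in> o(\<lambda>x. 1 / real x)"
    and I: "open I" "is_interval I" "I \<noteq> {}"
  obtains P Q a \<zeta> where "tuned_convergents P Q a \<zeta> \<Psi>" "\<zeta> \<in> I" "\<zeta> \<notin> range z"
proof -
  obtain p0 q0 p1 q1 :: int where init: "0 < q0" "q0 \<le> q1" "\<bar>p1 * q0 - p0 * q1\<bar> = 1"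
    "of_int p0 / of_int q0 \<in> I" "of_int p1 / of_int q1 \<in> I"
    using adjacent_fractions_in_open I by metis
  \<comment> \<open>The clause for \<open>n = 0\<close> pins the initial state, which dependent
    choice would otherwise leave open.\<close>
  define good where "good n s = (case s of (p :: int, q, p' :: int, q') \<Rightarrow> 0 < q \<and> q \<le> q' \<and>
      (n = 0 \<longrightarrow> s = (p0, q0, p1, q1)))" for n :: nat and s
  define step where "step n s t = (case s of (p, q, p', q') \<Rightarrow> \<exists>a::int. 1 \<le> a \<and>
      t = (p', q', a * p' + p, a * q' + q) \<and>
      1 / \<Psi> (nat q') \<le> of_int (a * q' + q) \<and>
      of_int (a * q' + q) \<le> 1 / \<Psi> (nat q') + 3 * of_int q' \<and>
      (\<bar>z n * of_int q' - of_int p'\<bar> \<le> 1 / (of_int (a * q' + q) + of_int q') \<or>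
       1 / of_int (a * q' + q) \<le> \<bar>z n * of_int q' - of_int p'\<bar>))" for n s t
  have "\<exists>f. \<forall>n. good n (f n) \<and> step n (f n) (f (Suc n))"
  proof (rule dependent_nat_choice)
    show "\<exists>s. good 0 s" using init by (auto simp: good_def)
  next
    fix s n assume "good n s"
    then obtain p q p' q' where s: "s = (p, q, p', q')" "0 < q" "q \<le> q'"
      by (auto simp: good_def)
    have "0 < \<Psi> (nat q')" using s by (intro pos) linarith
    then obtain a where a: "1 \<le> a" "1 / \<Psi> (nat q') \<le> of_int (a * q' + q)"
      "of_int (a * q' + q) \<le> 1 / \<Psi> (nat q') + 3 * of_int q'"
      "\<bar>z n * of_int q' - of_int p'\<bar> \<le> 1 / (of_int (a * q' + q) + of_int q') \<or>
       1 / of_int (a * q' + q) \<le> \<bar>z n * of_int q' - of_int p'\<bar>"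
      using next_partial_quotient s(2,3) by blast
    have "1 * q' \<le> a * q'" using a(1) s by (intro mult_right_mono) auto
    then have "q' \<le> a * q' + q" using s by linarith
    then have "good (Suc n) (p', q', a * p' + p, a * q' + q)"
      using s unfolding good_def by simp
    moreover have "step n s (p', q', a * p' + p, a * q' + q)"
      unfolding step_def s using a by blast
    ultimately show "\<exists>t. good (Suc n) t \<and> step n s t" by blast
  qed
  then obtain f where f: "\<And>n. good n (f n)" "\<And>n. step n (f n) (f (Suc n))" by blast
  define P where "P n = fst (f n)" for n
  define Q where "Q n = fst (snd (f n))" for n
  have f_eq: "f n = (P n, Q n, P (Suc n), Q (Suc n))" for n
    using f(2)[of n] by (auto simp: step_def P_def Q_def split: prod.splits)
  have "\<exists>a. \<forall>n. 1 \<le> a n \<and> P (Suc (Suc n)) = a n * P (Suc n) + P n \<and>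
      Q (Suc (Suc n)) = a n * Q (Suc n) + Q n"
  proof (rule choice, rule allI)
    fix n show "\<exists>a. 1 \<le> a \<and> P (Suc (Suc n)) = a * P (Suc n) + P n \<and>
      Q (Suc (Suc n)) = a * Q (Suc n) + Q n"
      using f(2)[of n] by (auto simp: step_def f_eq)
  qed
  then obtain a where a: "\<And>n. 1 \<le> a n" "\<And>n. P (Suc (Suc n)) = a n * P (Suc n) + P n"
    "\<And>n. Q (Suc (Suc n)) = a n * Q (Suc n) + Q n" by blast
  have f0: "P 0 = p0" "Q 0 = q0" "P 1 = p1" "Q 1 = q1"
    using f(1)[of 0] by (auto simp: good_def f_eq)
  interpret convergents P Q a
    by unfold_locales (use init a f0 in simp_all)
  obtain \<zeta> where \<zeta>: "\<And>k. \<zeta> \<in> closed_segment (frac_conv k) (frac_conv (Suc k))"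
    by (rule exists_limit) blast
  interpret tuned_convergents P Q a \<zeta> \<Psi>
  proof unfold_locales
    fix k
    show "1 / \<Psi> (nat (Q (Suc k))) \<le> of_int (Q (Suc (Suc k)))"
      "of_int (Q (Suc (Suc k))) \<le> 1 / \<Psi> (nat (Q (Suc k))) + 3 * of_int (Q (Suc k))"
      using f(2)[of k] by (auto simp: step_def f_eq)
  qed (use \<zeta> pos small in auto)
  have "\<zeta> \<noteq> z n" for n
  proof
    assume z: "\<zeta> = z n"
    \<comment> \<open>Stage \<open>n\<close> concerns the error at index \<open>Suc n\<close>: it
      forces \<open>z n\<close> to violate one of the strict bounds that \<zeta> satisfies
      there.\<close>
    have "\<bar>z n * of_int (Q (Suc n)) - of_int (P (Suc n))\<bar>
        \<le> 1 / (of_int (Q (Suc (Suc n))) + of_int (Q (Suc n))) \<or>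
      1 / of_int (Q (Suc (Suc n))) \<le> \<bar>z n * of_int (Q (Suc n)) - of_int (P (Suc n))\<bar>"
      using f(2)[of n] by (auto simp: step_def f_eq)
    then show False
      using D_lower[of "Suc n"] D_upper[of "Suc n"]
      unfolding D_def unfolding z by linarith
  qed
  moreover have "closed_segment (frac_conv 0) (frac_conv (Suc 0)) \<subseteq> I"
    using init f0 I(2) by (intro closed_segment_subset) (auto simp: is_interval_convex_1)
  then have "\<zeta> \<in> I" using \<zeta>[of 0] by blast
  ultimately show ?thesis using that tuned_convergents_axioms by blast
qed

section \<open>Uncountability\<close>

lemma uncountableI_avoid:
  assumes "\<And>z :: nat \<Rightarrow> 'a. \<exists>x\<in>A. x \<notin> range z"
  shows "uncountable A"
  using assms unfolding uncountable_def by blast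

theorem theorem1p2:
  fixes \<Psi> :: "nat \<Rightarrow> real" and I :: "real set"
  assumes pos: "\<And>x. 1 \<le> x \<Longrightarrow> 0 < \<Psi> x"
    and small: "\<Psi> \<in> o(\<lambda>x. 1 / real x)"
    and I: "open I" "is_interval I" "I \<noteq> {}"
  shows "((\<forall>l x. 1 \<le> l \<longrightarrow> 1 \<le> x \<longrightarrow> \<Psi> (l * x) \<le> real l * \<Psi> x) \<longrightarrow>
            uncountable ((K1 \<Psi> - (\<Union>c\<in>{..<1::real}. K1 (\<lambda>x. c * \<Psi> x))) \<inter> I)) \<and>
         uncountable ((K1_star \<Psi> - (\<Union>c\<in>{..<1::real}. K1_star (\<lambda>x. c * \<Psi> x))) \<inter> I)"
proof (intro conjI impI uncountableI_avoid)
  fix z :: "nat \<Rightarrow> real"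
  \<comment> \<open>The construction uses only positivity and smallness of \<Psi>, so one point
    serves both conjuncts.\<close>
  obtain P Q a \<zeta> where t: "tuned_convergents P Q a \<zeta> \<Psi>" and \<zeta>: "\<zeta> \<in> I" "\<zeta> \<notin> range z"
    using exists_tuned_convergents[OF pos small I] by metis
  interpret tuned_convergents P Q a \<zeta> \<Psi> by (rule t)
  show "\<exists>x\<in>(K1_star \<Psi> - (\<Union>c\<in>{..<1}. K1_star (\<lambda>x. c * \<Psi> x))) \<inter> I. x \<notin> range z"
    using \<zeta> limit_in_K1_star limit_notin_K1_star by blast
  assume "\<forall>l x. 1 \<le> l \<longrightarrow> 1 \<le> x \<longrightarrow> \<Psi> (l * x) \<le> real l * \<Psi> x"
  then show "\<exists>x\<in>(K1 \<Psi> - (\<Union>c\<in>{..<1}. K1 (\<lambda>x. c * \<Psi> x))) \<inter> I. x \<notin> range z"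
    using \<zeta> limit_in_K1 limit_notin_K1 by blast
qed

end
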